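(* Let $A,B$ be parameters and consider the birational mapping $$(x_1,x_2,x_3,x_4,x_5,x_6)\mapsto(x_2,x_3,x_4,x_5,x_6,x_7),\qquad x_7=-\frac{x_1x_5x_6+A\,x_2x_4x_6+B\,x_3x_4x_5}{x_2x_3}.$$ Then the following two rational functions are integrals (are invariant under the mapping): $$(A^2+B)\frac{x_1x_6}{x_3x_4}+AB\left(\frac{x_1x_5}{x_2x_4}+\frac{x_2x_6}{x_3x_5}\right)+A\,\frac{x_1x_6}{x_3x_4}\left(\frac{x_1x_5}{x_2x_4}+\frac{x_2x_6}{x_3x_5}\right)+\left(\frac{x_1x_6}{x_3x_4}\right)^2$$ and $$\frac{Bx_3x_4+x_1x_6}{x_2x_5}-\frac{Ax_2x_4+x_1x_5}{x_3^2}-\frac{Ax_3x_5+x_2x_6}{x_4^2}.$$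
   Context: An integral of a mapping is a function $I$ with $I(x_2,\dots,x_7)=I(x_1,\dots,x_6)$ as rational functions of $x_1,\dots,x_6$. The mapping is the $(2,1)$-periodic reduction of the trilinear Boussinesq lattice equation, with its coefficients normalised so that $C=0$, $D=1$. *)

theory Defs
  imports
    "HOL-Library.Poly_Mapping"
    "HOL-Library.Numeral_Type"
    "HOL-Computational_Algebra.Fraction_Field"
begin

text \<open>
  A polynomial over \<open>'k\<close> in variables indexed by \<open>'v\<close> maps monomials (exponent
  vectors) to coefficients; the field of rational functions is its fraction field. The order on
  \<open>'v\<close> only serves to make the polynomial ring an instance of \<^class>\<open>idom\<close>.
\<close>

type_synonym ('v, 'k) polynomial = "('v \<Rightarrow>\<^sub>0 nat) \<Rightarrow>\<^sub>0 'k"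
type_synonym ('v, 'k) ratfun = "('v, 'k) polynomial fract"

definition Const :: "'k::field \<Rightarrow> ('v::{finite, linorder}, 'k) ratfun" where
  "Const c = Fract (Poly_Mapping.single 0 c) 1"

definition X :: "'v::{finite, linorder} \<Rightarrow> ('v, 'k::field) ratfun" where
  "X v = Fract (Poly_Mapping.single (Poly_Mapping.single v 1) 1) 1"

definition poly_subst ::
  "('v \<Rightarrow> ('w, 'k) ratfun) \<Rightarrow> ('v::{finite, linorder}, 'k::field) polynomial
     \<Rightarrow> ('w::{finite, linorder}, 'k) ratfun" where
  "poly_subst \<phi> p =
     (\<Sum>m\<in>Poly_Mapping.keys p.
        Const (Poly_Mapping.lookup p m) * (\<Prod>v\<in>UNIV. \<phi> v ^ Poly_Mapping.lookup m v))"

text \<open>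
  \<open>subst_to \<phi> f g\<close>: the composite of \<open>f\<close> with the rational map \<open>\<phi>\<close> is defined and equals
  \<open>g\<close>. It is a relation because the composite is undefined when every denominator of \<open>f\<close>
  vanishes identically along \<open>\<phi>\<close>.
\<close>

definition subst_to ::
  "('v \<Rightarrow> ('w, 'k) ratfun) \<Rightarrow> ('v::{finite, linorder}, 'k::field) ratfun
     \<Rightarrow> ('w::{finite, linorder}, 'k) ratfun \<Rightarrow> bool" where
  "subst_to \<phi> f g \<longleftrightarrow>
     (\<exists>p q. f = Fract p q \<and> poly_subst \<phi> q \<noteq> 0 \<and> g = poly_subst \<phi> p / poly_subst \<phi> q)"

definition is_birational ::
  "('v::{finite, linorder} \<Rightarrow> ('v, 'k::field) ratfun) \<Rightarrow> bool" where
  "is_birational \<phi> \<longleftrightarrow>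
     (\<exists>\<psi>. \<forall>v. subst_to \<psi> (\<phi> v) (X v) \<and> subst_to \<phi> (\<psi> v) (X v))"

definition is_integral ::
  "('v \<Rightarrow> ('v, 'k) ratfun) \<Rightarrow> ('v::{finite, linorder}, 'k::field) ratfun \<Rightarrow> bool" where
  "is_integral \<phi> f \<longleftrightarrow> subst_to \<phi> f f"

lemma poly_subst_superset:
  assumes "finite S" "Poly_Mapping.keys p \<subseteq> S"
  shows "poly_subst \<phi> p =
    (\<Sum>m\<in>S. Const (Poly_Mapping.lookup p m) * (\<Prod>v\<in>UNIV. \<phi> v ^ Poly_Mapping.lookup m v))"
  unfolding poly_subst_def
  by (rule sum.mono_neutral_left)
     (use assms in \<open>auto simp: Const_def in_keys_iff fract_collapse\<close>)

lemma Const_add: "Const (a + b) = Const a + Const b"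
  by (simp add: Const_def single_add)

lemma Const_mult: "Const (a * b) = Const a * Const b"
  by (simp add: Const_def mult_single)

lemma Const_0 [simp]: "Const 0 = 0"
  by (simp add: Const_def fract_collapse)

lemma Const_1 [simp]: "Const 1 = 1"
  by (simp add: Const_def fract_collapse)

lemma poly_subst_0 [simp]: "poly_subst \<phi> 0 = 0"
  by (simp add: poly_subst_def)

lemma poly_subst_add: "poly_subst \<phi> (p + q) = poly_subst \<phi> p + poly_subst \<phi> q"
proof -
  let ?S = "Poly_Mapping.keys p \<union> Poly_Mapping.keys q"
  have "Poly_Mapping.keys (p + q) \<subseteq> ?S" by (rule Poly_Mapping.keys_add)
  then show ?thesis
    by (simp add: poly_subst_superset[of ?S] lookup_add Const_add algebra_simps sum.distrib)
qed

lemma poly_subst_single: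
  "poly_subst \<phi> (Poly_Mapping.single m c) =
     Const c * (\<Prod>v\<in>UNIV. \<phi> v ^ Poly_Mapping.lookup m v)"
  by (subst poly_subst_superset[of "{m}"]) auto

lemma poly_subst_1 [simp]: "poly_subst \<phi> 1 = 1"
  by (simp add: poly_subst_single flip: single_one)

lemma polynomial_induct [case_names zero add_single]:
  assumes "P 0" "\<And>p m c. P p \<Longrightarrow> P (p + Poly_Mapping.single m c)"
  shows "P (p :: ('v, 'k::field) polynomial)"
proof (induction p rule: update_induct)
  case const
  then show ?case by (rule assms(1))
next
  case (update f a b)
  have "Poly_Mapping.update a b f = f + Poly_Mapping.single a b"
    using update(1)
    by (intro poly_mapping_eqI) (auto simp: lookup_update lookup_add lookup_single in_keys_iff)
  then show ?case using assms(2)[OF update(3)] by simp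
qed

lemma poly_subst_mult: "poly_subst \<phi> (p * q) = poly_subst \<phi> p * poly_subst \<phi> q"
proof -
  have single: "poly_subst \<phi> (Poly_Mapping.single m a * Poly_Mapping.single n b) =
      poly_subst \<phi> (Poly_Mapping.single m a) * poly_subst \<phi> (Poly_Mapping.single n b)" for m n a b
    by (simp add: mult_single poly_subst_single Const_mult lookup_add power_add prod.distrib)
  have left: "poly_subst \<phi> (Poly_Mapping.single m a * q) =
      poly_subst \<phi> (Poly_Mapping.single m a) * poly_subst \<phi> q" for m a
    by (induction q rule: polynomial_induct) (simp_all add: single poly_subst_add algebra_simps)
  show ?thesis
    by (induction p rule: polynomial_induct) (simp_all add: left poly_subst_add distrib_right)
qed

lemma poly_subst_minus: "poly_subst \<phi> (- p) = - poly_subst \<phi> p"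
  using poly_subst_add[of \<phi> p "- p"] by (simp add: eq_neg_iff_add_eq_0 add.commute)

lemma subst_toE:
  assumes "subst_to \<phi> f g"
  obtains p q where "f = Fract p q" "q \<noteq> 0" "poly_subst \<phi> q \<noteq> 0"
    "g = poly_subst \<phi> p / poly_subst \<phi> q"
  using assms unfolding subst_to_def by force

lemma subst_to_unique:
  assumes "subst_to \<phi> f g" "subst_to \<phi> f h"
  shows "g = h"
proof -
  obtain p q where 1: "f = Fract p q" "q \<noteq> 0" "poly_subst \<phi> q \<noteq> 0"
    "g = poly_subst \<phi> p / poly_subst \<phi> q" using assms(1) by (rule subst_toE)
  obtain r s where 2: "f = Fract r s" "s \<noteq> 0" "poly_subst \<phi> s \<noteq> 0"
    "h = poly_subst \<phi> r / poly_subst \<phi> s" using assms(2) by (rule subst_toE)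
  have "p * s = r * q" using 1 2 by (simp add: eq_fract)
  then have "poly_subst \<phi> (p * s) = poly_subst \<phi> (r * q)" by simp
  then show ?thesis using 1 2 by (simp add: poly_subst_mult frac_eq_eq)
qed

lemma subst_to_Const: "subst_to \<phi> (Const c) (Const c)"
  unfolding subst_to_def
  by (rule exI[of _ "Poly_Mapping.single 0 c"], rule exI[of _ 1])
     (simp add: Const_def[of c, where 'v = 'a] poly_subst_single)

lemma subst_to_X: "subst_to \<phi> (X v) (\<phi> v)"
proof -
  have "(\<Prod>u\<in>UNIV. \<phi> u ^ Poly_Mapping.lookup (Poly_Mapping.single v (1::nat)) u) =
      (\<Prod>u\<in>UNIV. if v = u then \<phi> u else 1)"
    by (rule prod.cong) (auto simp: lookup_single)
  also have "\<dots> = \<phi> v" by simp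
  finally have "poly_subst \<phi> (Poly_Mapping.single (Poly_Mapping.single v 1) 1) = \<phi> v"
    by (simp add: poly_subst_single)
  then show ?thesis unfolding subst_to_def X_def
    by (intro exI[of _ "Poly_Mapping.single (Poly_Mapping.single v 1) 1"] exI[of _ 1]) simp
qed

lemma subst_to_add:
  assumes "subst_to \<phi> f f'" "subst_to \<phi> g g'"
  shows "subst_to \<phi> (f + g) (f' + g')"
proof -
  obtain p q where 1: "f = Fract p q" "q \<noteq> 0" "poly_subst \<phi> q \<noteq> 0"
    "f' = poly_subst \<phi> p / poly_subst \<phi> q" using assms(1) by (rule subst_toE)
  obtain r s where 2: "g = Fract r s" "s \<noteq> 0" "poly_subst \<phi> s \<noteq> 0"
    "g' = poly_subst \<phi> r / poly_subst \<phi> s" using assms(2) by (rule subst_toE)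
  show ?thesis unfolding subst_to_def
    by (intro exI[of _ "p * s + r * q"] exI[of _ "q * s"])
       (use 1 2 in \<open>simp add: poly_subst_mult poly_subst_add add_frac_eq\<close>)
qed

lemma subst_to_minus:
  assumes "subst_to \<phi> f f'"
  shows "subst_to \<phi> (- f) (- f')"
proof -
  obtain p q where 1: "f = Fract p q" "q \<noteq> 0" "poly_subst \<phi> q \<noteq> 0"
    "f' = poly_subst \<phi> p / poly_subst \<phi> q" using assms(1) by (rule subst_toE)
  show ?thesis unfolding subst_to_def
    by (intro exI[of _ "- p"] exI[of _ q]) (use 1 in \<open>simp add: poly_subst_minus\<close>)
qed

lemma subst_to_diff:
  assumes "subst_to \<phi> f f'" "subst_to \<phi> g g'"
  shows "subst_to \<phi> (f - g) (f' - g')"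
  using subst_to_add[OF assms(1) subst_to_minus[OF assms(2)]] by simp

lemma subst_to_mult:
  assumes "subst_to \<phi> f f'" "subst_to \<phi> g g'"
  shows "subst_to \<phi> (f * g) (f' * g')"
proof -
  obtain p q where 1: "f = Fract p q" "q \<noteq> 0" "poly_subst \<phi> q \<noteq> 0"
    "f' = poly_subst \<phi> p / poly_subst \<phi> q" using assms(1) by (rule subst_toE)
  obtain r s where 2: "g = Fract r s" "s \<noteq> 0" "poly_subst \<phi> s \<noteq> 0"
    "g' = poly_subst \<phi> r / poly_subst \<phi> s" using assms(2) by (rule subst_toE)
  show ?thesis unfolding subst_to_def
    by (intro exI[of _ "p * r"] exI[of _ "q * s"]) (use 1 2 in \<open>simp add: poly_subst_mult\<close>)
qed

lemma subst_to_divide: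
  assumes "subst_to \<phi> f f'" "subst_to \<phi> g g'" "g' \<noteq> 0"
  shows "subst_to \<phi> (f / g) (f' / g')"
proof -
  obtain p q where 1: "f = Fract p q" "q \<noteq> 0" "poly_subst \<phi> q \<noteq> 0"
    "f' = poly_subst \<phi> p / poly_subst \<phi> q" using assms(1) by (rule subst_toE)
  obtain r s where 2: "g = Fract r s" "s \<noteq> 0" "poly_subst \<phi> s \<noteq> 0"
    "g' = poly_subst \<phi> r / poly_subst \<phi> s" using assms(2) by (rule subst_toE)
  have "poly_subst \<phi> r \<noteq> 0" using 2 assms(3) by auto
  then show ?thesis unfolding subst_to_def
    by (intro exI[of _ "p * s"] exI[of _ "q * r"]) (use 1 2 in \<open>simp add: poly_subst_mult\<close>)
qed

lemma subst_to_power: "subst_to \<phi> f f' \<Longrightarrow> subst_to \<phi> (f ^ n) (f' ^ n)"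
proof (induction n)
  case 0
  show ?case using subst_to_Const[of \<phi> 1] by simp
next
  case (Suc n)
  then show ?case by (simp add: subst_to_mult)
qed

lemmas subst_to_intros =
  subst_to_Const subst_to_X subst_to_add subst_to_minus subst_to_diff subst_to_mult
  subst_to_divide subst_to_power

lemma X_nonzero [simp]: "X v \<noteq> 0"
proof
  assume "X v = (0 :: ('a, 'b) ratfun)"
  then have "Poly_Mapping.single (Poly_Mapping.single v 1) 1 = (0 :: ('a, 'b) polynomial)"
    by (simp add: X_def Zero_fract_def eq_fract)
  then have "Poly_Mapping.lookup (Poly_Mapping.single (Poly_Mapping.single v (1::nat)) (1::'b))
      (Poly_Mapping.single v 1) = 0"
    by (simp only: lookup_zero)
  then show False by simp
qed

text \<open>
  The elements of type \<open>6\<close> are the residues modulo 6, so \<open>6\<close> is another name for \<open>0\<close>,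
  and \<open>i + 1\<close> is the successor of \<open>i\<close> for \<open>i = 1, \<dots>, 5\<close>.
\<close>

definition boussinesq_map :: "'k::field \<Rightarrow> 'k \<Rightarrow> 6 \<Rightarrow> (6, 'k) ratfun" where
  "boussinesq_map A B i =
     (if i = 6
      then - ((X 1 * X 5 * X 6 + Const A * X 2 * X 4 * X 6 + Const B * X 3 * X 4 * X 5)
              / (X 2 * X 3))
      else X (i + 1))"

lemma cases_6:
  fixes i :: 6
  obtains "i = 1" | "i = 2" | "i = 3" | "i = 4" | "i = 5" | "i = 6"
proof (cases i)
  case (of_int z)
  then have "z = 0 \<or> z = 1 \<or> z = 2 \<or> z = 3 \<or> z = 4 \<or> z = 5" by auto
  then show ?thesis using of_int that by auto
qed

lemma boussinesq_map_simps:
  "boussinesq_map A B 1 = X 2" "boussinesq_map A B 2 = X 3" "boussinesq_map A B 3 = X 4"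
  "boussinesq_map A B 4 = X 5" "boussinesq_map A B 5 = X 6"
  "boussinesq_map A B 6 =
     - ((X 1 * X 5 * X 6 + Const A * X 2 * X 4 * X 6 + Const B * X 3 * X 4 * X 5)
        / (X 2 * X 3))"
  by (simp_all add: boussinesq_map_def)

lemma is_birational_boussinesq_map: "is_birational (boussinesq_map A B)"
proof -
  let ?f = "boussinesq_map A B"
  define g :: "6 \<Rightarrow> (6, 'a) ratfun" where
    "g = (\<lambda>i. if i = 1
       then - ((X 6 * X 1 * X 2 + Const A * X 1 * X 3 * X 5 + Const B * X 2 * X 3 * X 4)
               / (X 4 * X 5))
       else X (i - 1))"
  have g: "g 1 = - ((X 6 * X 1 * X 2 + Const A * X 1 * X 3 * X 5 + Const B * X 2 * X 3 * X 4)
               / (X 4 * X 5))"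
    "g 2 = X 1" "g 3 = X 2" "g 4 = X 3" "g 5 = X 4" "g 6 = X 5"
    by (simp_all add: g_def)
  note f = boussinesq_map_simps[of A B]
  have fg: "subst_to g (?f i) (X i)" for i
  proof (cases i rule: cases_6)
    case 6
    have "subst_to g (?f 6)
      (- ((g 1 * g 5 * g 6 + Const A * g 2 * g 4 * g 6 + Const B * g 3 * g 4 * g 5)
        / (g 2 * g 3)))"
      unfolding f by (intro subst_to_intros) (simp add: g)
    also have "(- ((g 1 * g 5 * g 6 + Const A * g 2 * g 4 * g 6 + Const B * g 3 * g 4 * g 5)
        / (g 2 * g 3))) = X 6"
      unfolding g by (simp add: field_simps)
    finally show ?thesis using 6 by simp
  qed (simp_all only: f, (metis subst_to_X g)+)
  have gf: "subst_to ?f (g i) (X i)" for i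
  proof (cases i rule: cases_6)
    case 1
    have "subst_to ?f (g 1)
      (- ((?f 6 * ?f 1 * ?f 2 + Const A * ?f 1 * ?f 3 * ?f 5 + Const B * ?f 2 * ?f 3 * ?f 4)
        / (?f 4 * ?f 5)))"
      unfolding g by (intro subst_to_intros) (simp add: f)
    also have "(- ((?f 6 * ?f 1 * ?f 2 + Const A * ?f 1 * ?f 3 * ?f 5 + Const B * ?f 2 * ?f 3 * ?f 4)
        / (?f 4 * ?f 5))) = X 1"
      unfolding f by (simp add: field_simps)
    finally show ?thesis using 1 by simp
  qed (simp_all only: g, (metis subst_to_X f)+)
  show ?thesis unfolding is_birational_def using fg gf by blast
qed

end

(*
  Put p = x1 x5 / (x2 x4) and q = x2 x6 / (x3 x5). Then x1 x6 / (x3 x4) = p q, so the first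
  function depends on (p, q) only, and on the pair the mapping acts as
  (p, q) -> (q, - (p + A + B / q)), which preserves it. The mapping permutes the three
  signed terms of the second function cyclically.
*)
theory Submission
  imports Defs
begin

text \<open>The claim is an identity in an arbitrary field, with \<open>x7\<close> a separate
  element, so that it can be used in the field of rational functions with \<open>x7\<close> the last
  component of the mapping.\<close>

lemma trilinear_integral_1:
  fixes a b x1 x2 x3 x4 x5 x6 x7 :: "'a::field"
  assumes nz: "x2 \<noteq> 0" "x3 \<noteq> 0" "x4 \<noteq> 0" "x5 \<noteq> 0" "x6 \<noteq> 0"
    and x7: "x7 = - ((x1 * x5 * x6 + a * x2 * x4 * x6 + b * x3 * x4 * x5) / (x2 * x3))"
  shows "(a ^ 2 + b) * ((x2 * x7) / (x4 * x5))
        + a * b * ((x2 * x6) / (x3 * x5) + (x3 * x7) / (x4 * x6))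
        + a * ((x2 * x7) / (x4 * x5)) * ((x2 * x6) / (x3 * x5) + (x3 * x7) / (x4 * x6))
        + ((x2 * x7) / (x4 * x5)) ^ 2
      = (a ^ 2 + b) * ((x1 * x6) / (x3 * x4))
        + a * b * ((x1 * x5) / (x2 * x4) + (x2 * x6) / (x3 * x5))
        + a * ((x1 * x6) / (x3 * x4)) * ((x1 * x5) / (x2 * x4) + (x2 * x6) / (x3 * x5))
        + ((x1 * x6) / (x3 * x4)) ^ 2"
proof -
  define p q s where "p = (x1 * x5) / (x2 * x4)" and "q = (x2 * x6) / (x3 * x5)"
    and "s = p + a + b / q"
  have q0: "q \<noteq> 0" using nz by (simp add: q_def)
  have u: "(x1 * x6) / (x3 * x4) = p * q"
    using nz by (simp add: p_def q_def)
  have q': "(x3 * x7) / (x4 * x6) = - s"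
    unfolding x7 s_def p_def q_def using nz by (simp add: field_simps)
  have u': "(x2 * x7) / (x4 * x5) = - (q * s)"
    unfolding x7 s_def p_def q_def using nz by (simp add: field_simps)
  \<comment> \<open>Solving for \<open>b\<close> removes the only division. The function equals
    \<open>(p + a) * (q + a) * (p * q + b) - a^2 * b\<close>, and with this \<open>b\<close> the
    product is \<open>q * (p + a) * (q + a) * (s - a)\<close>, both for \<open>(p, q)\<close> and
    for \<open>(q, - s)\<close>.\<close>
  have b: "b = q * (s - p - a)" using q0 by (simp add: s_def)
  show ?thesis
    unfolding u u' q' p_def[symmetric] q_def[symmetric] unfolding b by algebra
qed

lemma trilinear_integral_2:
  fixes a b x1 x2 x3 x4 x5 x6 x7 :: "'a::field"
  assumes nz: "x2 \<noteq> 0" "x3 \<noteq> 0" "x4 \<noteq> 0" "x5 \<noteq> 0" "x6 \<noteq> 0"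
    and x7: "x7 = - ((x1 * x5 * x6 + a * x2 * x4 * x6 + b * x3 * x4 * x5) / (x2 * x3))"
  shows "(b * x4 * x5 + x2 * x7) / (x3 * x6)
        - (a * x3 * x5 + x2 * x6) / x4 ^ 2 - (a * x4 * x6 + x3 * x7) / x5 ^ 2
      = (b * x3 * x4 + x1 * x6) / (x2 * x5)
        - (a * x2 * x4 + x1 * x5) / x3 ^ 2 - (a * x3 * x5 + x2 * x6) / x4 ^ 2"
proof -
  \<comment> \<open>Inserting \<open>x7\<close> cancels \<open>b\<close> here and \<open>a\<close>
    in the next equation. The remaining term of the image is a mere index shift and already stands
    on both sides.\<close>
  have "(b * x4 * x5 + x2 * x7) / (x3 * x6) = - ((a * x2 * x4 + x1 * x5) / x3 ^ 2)"
    unfolding x7 using nz by (simp add: field_simps power2_eq_square)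
  moreover have "(a * x4 * x6 + x3 * x7) / x5 ^ 2 = - ((b * x3 * x4 + x1 * x6) / (x2 * x5))"
    unfolding x7 using nz by (simp add: field_simps power2_eq_square)
  ultimately show ?thesis by simp
qed

theorem mainTheorem5:
  fixes A B :: "'k::field"
  shows
    "is_integral (boussinesq_map A B)
       ((Const A ^ 2 + Const B) * ((X 1 * X 6) / (X 3 * X 4))
        + Const A * Const B * ((X 1 * X 5) / (X 2 * X 4) + (X 2 * X 6) / (X 3 * X 5))
        + Const A * ((X 1 * X 6) / (X 3 * X 4))
            * ((X 1 * X 5) / (X 2 * X 4) + (X 2 * X 6) / (X 3 * X 5))
        + ((X 1 * X 6) / (X 3 * X 4)) ^ 2)
     \<and> is_integral (boussinesq_map A B)
       ((Const B * X 3 * X 4 + X 1 * X 6) / (X 2 * X 5)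
        - (Const A * X 2 * X 4 + X 1 * X 5) / (X 3) ^ 2
        - (Const A * X 3 * X 5 + X 2 * X 6) / (X 4) ^ 2)"
    (is "is_integral ?f ?I1 \<and> is_integral ?f ?I2")
proof
  note f = boussinesq_map_simps[of A B]
  have "subst_to ?f ?I1
     ((Const A ^ 2 + Const B) * ((?f 1 * ?f 6) / (?f 3 * ?f 4))
      + Const A * Const B * ((?f 1 * ?f 5) / (?f 2 * ?f 4) + (?f 2 * ?f 6) / (?f 3 * ?f 5))
      + Const A * ((?f 1 * ?f 6) / (?f 3 * ?f 4))
          * ((?f 1 * ?f 5) / (?f 2 * ?f 4) + (?f 2 * ?f 6) / (?f 3 * ?f 5))
      + ((?f 1 * ?f 6) / (?f 3 * ?f 4)) ^ 2)"
    \<comment> \<open>The denominators involve only \<open>X 2\<close> to \<open>X 5\<close>, whose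
      images are variables and hence nonzero.\<close>
    by (intro subst_to_intros) (simp_all add: f(1-5))
  also have "\<dots> = ?I1"
    \<comment> \<open>\<open>?f 6\<close> stays folded so that it matches \<open>x7\<close>; its
      formula \<open>f(6)\<close> is then the hypothesis on \<open>x7\<close>.\<close>
    unfolding f(1-5) by (rule trilinear_integral_1) (simp_all add: f(6))
  finally show "is_integral ?f ?I1" by (simp only: is_integral_def)
  have "subst_to ?f ?I2
     ((Const B * ?f 3 * ?f 4 + ?f 1 * ?f 6) / (?f 2 * ?f 5)
      - (Const A * ?f 2 * ?f 4 + ?f 1 * ?f 5) / ?f 3 ^ 2
      - (Const A * ?f 3 * ?f 5 + ?f 2 * ?f 6) / ?f 4 ^ 2)"
    by (intro subst_to_intros) (simp_all add: f(1-5))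
  also have "\<dots> = ?I2"
    unfolding f(1-5) by (rule trilinear_integral_2) (simp_all add: f(6))
  finally show "is_integral ?f ?I2" by (simp only: is_integral_def)
qed

end
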